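(* Let $G$ be a GSOS language. Then for all persistent $P,Q\in\mathbb{T}(\Sigma_G)$: $\mathbb{A}(G)\models P=Q$ if and only if $P\mathrel{\underline{\leftrightarrow}}^{RM}_G Q$.
   Context: Let $\mathit{Var}$ be a countably infinite set of variables and $\mathsf{Act}$ a fixed nonempty finite set of actions. A signature $\Sigma$ is a set of operation symbols each with an arity; $\mathbb{T}(\Sigma)$ is the set of terms over $\Sigma$ and $\mathit{Var}$; closed terms have no variables. A GSOS rule over $\Sigma$ has the form $$\frac{\bigcup_{i=1}^{l}\{x_i \xrightarrow{a_{ij}} y_{ij} \mid 1\le j\le m_i\}\ \cup\ \bigcup_{i=1}^{l}\{x_i \not\xrightarrow{b_{ik}} \mid 1\le k\le n_i\}}{f(x_1,\dots,x_l)\xrightarrow{c} C[\vec x,\vec y]}$$ with all variables distinct, $a_{ij},b_{ik},c\in\mathsf{Act}$, $f$ of arity $l$, $C$ a term with variables among $\vec x,\vec y$. A GSOS language $G=(\Sigma_G,R_G)$ is a finite signature with a finite set of GSOS rules; its transition relation $\to_G$ on closed terms is defined by structural induction: $f(\vec p)\xrightarrow{c}_G q$ iff some rule with principal operation $f$ and action $c$ and some closed substitution $\sigma$ with $\sigma(x_i)=p_i$ satisfy all antecedents ($\sigma(x_i)\xrightarrow{a_{ij}}_G\sigma(y_{ij})$; $\sigma(x_i)$ has no $b_{ik}$-transition) and $q=C\sigma$. Bisimilarity $\mathrel{\underline{\leftrightarrow}}_G$ on closed terms is the largest symmetric relation such that related $p,q$ and $p\xrightarrow{a}p'$ imply $q\xrightarrow{a}q'$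 with $p',q'$ related. $\mathbb{A}(G)\models P=Q$ means $P\sigma\mathrel{\underline{\leftrightarrow}}_G Q\sigma$ for all closed substitutions $\sigma$. Ruloids: a ruloid for a term $D$ has the shape of a GSOS rule but with source $D$ (all variables distinct); sourcevars are the $x_i$, targetvars the $y_{ij}$; $\mathrm{ante}(\rho)$ is its set of antecedents. It is sound if every closed substitution satisfying its antecedents yields a transition of $\to_G$ when applied to its consequent; a set of ruloids is supporting for $D$ and $c$ if its consequents are $D\xrightarrow{c}\cdot$ and every closed transition $D[\vec p]\xrightarrow{c}p$ arises by instantiating one of them with a closed substitution satisfying its antecedents. For each term $P$, $\mathrm{ruloids}(P)$ is a fixed finite set of ruloids, the union over $c$ of finite sets sound and supporting for $P$ and $c$. A term $P$ is persistent iff every ruloid in $\mathrm{ruloids}(P)$ has the form $\frac{H}{P\xrightarrow{a}P}$ for some $a\in\mathsf{Act}$. A ruloid $\rho=\frac{H}{P\xrightarrow{a}P'}$ is valid for $P$ iff $\rho=\rho'\sigma$ for some $\rho'\in\mathrm{ruloids}(P)$ and injective $\sigma:\mathrm{targetvars}(\rho')\to\mathit{Var}\setminus\mathrm{sourcevars}(\rho)$. Initial transition formulae: $F::=\mathsf{True}\mid x\xrightarrow{a}\mid\neg F\mid F\wedge F$; a closed substitution $\sigma$ satisfies $x\xrightarrow{a}$ iff $\sigma(x)\xrightarrow{a}_G p$ for some $p$; $\models_G F\Rightarrow F'$ iff every closed substitution satisfying $F$ satisfies $F'$. $\mathrm{hyps}(H)$ is the conjunction of $x\xrightarrow{a}$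 for $x\xrightarrow{a}y\in H$ and $\neg(x\xrightarrow{b})$ for $x\not\xrightarrow{b}\in H$; $\mathrm{hyps}(\rho)=\mathrm{hyps}(\mathrm{ante}(\rho))$; $\mathrm{hyps}(J)=\bigvee_{\rho'\in J}\mathrm{hyps}(\mathrm{ante}(\rho'))$. A symmetric relation $\approx$ on $\mathbb{T}(\Sigma_G)$ is a rule-matching bisimulation if $P\approx Q$ implies: for each $\rho=\frac{H}{P\xrightarrow{a}P'}\in\mathrm{ruloids}(P)$ there is a finite set $J$ of valid ruloids for $Q$ such that (1) for every $\rho'=\frac{H'}{Q\xrightarrow{a'}Q'}\in J$: (a) $a'=a$; (b) $P'\approx Q'$; (c) $(\mathrm{targetvars}(\rho')\cup\mathrm{targetvars}(\rho))\cap(\mathrm{sourcevars}(\rho)\cup\mathrm{sourcevars}(\rho'))=\emptyset$; (d) if $y\in\mathrm{targetvars}(\rho)\cap\mathrm{targetvars}(\rho')$ then $x\xrightarrow{b}y\in H\cap H'$ for some $x\in\mathrm{sourcevars}(\rho)\cap\mathrm{sourcevars}(\rho')$ and action $b$; and (2) $\models_G\mathrm{hyps}(\rho)\Rightarrow\mathrm{hyps}(J)$. $P\mathrel{\underline{\leftrightarrow}}^{RM}_G Q$ iff some rule-matching bisimulation relates $P$ and $Q$. Standing assumption: $G$ contains no junk rules (rules supporting no transition of $\to_G$), and the ruloid sets considered contain no junk ruloids.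
   Formalization: Additionally assumes that the target variables of the ruloids in ruloids(P) do not occur in Q and those of ruloids(Q) do not occur in P; without this, condition (1c) makes the claim false for some persistent P, Q. *)

theory Defs
  imports Main "HOL-Library.Countable" "HOL-Library.Infinite_Typeclass"
begin

datatype (ops: 'f, vars: 'v) trm = Var 'v | Op 'f "('f, 'v) trm list"

primrec subst :: "('f, 'v) trm \<Rightarrow> ('v \<Rightarrow> ('f, 'v) trm) \<Rightarrow> ('f, 'v) trm" where
  "subst (Var x) \<sigma> = \<sigma> x"
| "subst (Op f ts) \<sigma> = Op f (map (\<lambda>t. subst t \<sigma>) ts)"

text \<open>Antecedents \<open>x -a-> y\<close> and \<open>x -b/->\<close>.\<close>

datatype ('a, 'v) literal = Pos 'v 'a 'v | Neg 'v 'a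

text \<open>One record serves for GSOS rules and for ruloids; a GSOS rule is a ruloid whose source is
  an operation symbol applied to distinct variables.\<close>

record ('f, 'a, 'v) ruloid =
  ante :: "('a, 'v) literal set"
  source :: "('f, 'v) trm"
  action :: 'a
  target :: "('f, 'v) trm"

record ('f, 'a, 'v) gsos =
  symbols :: "'f set"
  arity :: "'f \<Rightarrow> nat"
  rules :: "('f, 'a, 'v) ruloid set"

fun wf_trm :: "('f, 'a, 'v) gsos \<Rightarrow> ('f, 'v) trm \<Rightarrow> bool" where
  "wf_trm G (Var x) \<longleftrightarrow> True"
| "wf_trm G (Op f ts) \<longleftrightarrow> f \<in> symbols G \<and> length ts = arity G f \<and> (\<forall>t\<in>set ts. wf_trm G t)"

definition terms :: "('f, 'a, 'v) gsos \<Rightarrow> ('f, 'v) trm set" where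
  "terms G = {t. wf_trm G t}"

definition closed_terms :: "('f, 'a, 'v) gsos \<Rightarrow> ('f, 'v) trm set" where
  "closed_terms G = {t \<in> terms G. vars t = {}}"

definition closed_subst :: "('f, 'a, 'v) gsos \<Rightarrow> ('v \<Rightarrow> ('f, 'v) trm) \<Rightarrow> bool" where
  "closed_subst G \<sigma> \<longleftrightarrow> (\<forall>x. \<sigma> x \<in> closed_terms G)"

definition sourcevars :: "('f, 'a, 'v) ruloid \<Rightarrow> 'v set" where
  "sourcevars \<rho> = vars (source \<rho>)"

definition targetvars :: "('f, 'a, 'v) ruloid \<Rightarrow> 'v set" where
  "targetvars \<rho> = {y. \<exists>x a. Pos x a y \<in> ante \<rho>}"

text \<open>The \<open>x\<^sub>i\<close> are the variables of the source. That the \<open>y\<^sub>i\<^sub>j\<close> are distinct means that each of them is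
  the target of only one positive antecedent.\<close>

definition is_ruloid :: "('f, 'a, 'v) gsos \<Rightarrow> ('f, 'v) trm \<Rightarrow> ('f, 'a, 'v) ruloid \<Rightarrow> bool" where
  "is_ruloid G D \<rho> \<longleftrightarrow>
     source \<rho> = D \<and> D \<in> terms G \<and> target \<rho> \<in> terms G \<and> finite (ante \<rho>) \<and>
     (\<forall>x a y. Pos x a y \<in> ante \<rho> \<longrightarrow> x \<in> sourcevars \<rho>) \<and>
     (\<forall>x b. Neg x b \<in> ante \<rho> \<longrightarrow> x \<in> sourcevars \<rho>) \<and>
     sourcevars \<rho> \<inter> targetvars \<rho> = {} \<and>
     (\<forall>x a x' a' y. Pos x a y \<in> ante \<rho> \<longrightarrow> Pos x' a' y \<in> ante \<rho> \<longrightarrow> x = x' \<and> a = a') \<and>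
     vars (target \<rho>) \<subseteq> sourcevars \<rho> \<union> targetvars \<rho>"

definition is_gsos_rule :: "('f, 'a, 'v) gsos \<Rightarrow> ('f, 'a, 'v) ruloid \<Rightarrow> bool" where
  "is_gsos_rule G \<rho> \<longleftrightarrow>
     (\<exists>f xs. distinct xs \<and> is_ruloid G (Op f (map Var xs)) \<rho>)"

definition gsos_language :: "('f, 'a, 'v) gsos \<Rightarrow> bool" where
  "gsos_language G \<longleftrightarrow>
     finite (symbols G) \<and> finite (rules G) \<and> (\<forall>\<rho>\<in>rules G. is_gsos_rule G \<rho>)"

text \<open>The antecedents are checked argument by argument to make the structural recursion explicit.
  The variables tested in a GSOS rule are instantiated by the arguments of the source, so no antecedent
  is missed; see \<open>trans_iff_supports\<close> below.\<close>

fun trans :: "('f, 'a, 'v) gsos \<Rightarrow> ('f, 'v) trm \<Rightarrow> 'a \<Rightarrow> ('f, 'v) trm \<Rightarrow> bool" where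
  "trans G (Var x) c q \<longleftrightarrow> False"
| "trans G (Op f ps) c q \<longleftrightarrow>
     (\<exists>\<rho>\<in>rules G. \<exists>\<sigma>. closed_subst G \<sigma> \<and>
        subst (source \<rho>) \<sigma> = Op f ps \<and> action \<rho> = c \<and> subst (target \<rho>) \<sigma> = q \<and>
        (\<forall>p\<in>set ps. \<forall>x. \<sigma> x = p \<longrightarrow>
           (\<forall>a y. Pos x a y \<in> ante \<rho> \<longrightarrow> trans G p a (\<sigma> y)) \<and>
           (\<forall>b. Neg x b \<in> ante \<rho> \<longrightarrow> \<not> (\<exists>p'. trans G p b p'))))"

primrec sat_literal :: "('f, 'a, 'v) gsos \<Rightarrow> ('v \<Rightarrow> ('f, 'v) trm) \<Rightarrow> ('a, 'v) literal \<Rightarrow> bool" where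
  "sat_literal G \<sigma> (Pos x a y) \<longleftrightarrow> trans G (\<sigma> x) a (\<sigma> y)"
| "sat_literal G \<sigma> (Neg x b) \<longleftrightarrow> \<not> (\<exists>p. trans G (\<sigma> x) b p)"

definition supports ::
  "('f, 'a, 'v) gsos \<Rightarrow> ('f, 'a, 'v) ruloid \<Rightarrow> ('f, 'v) trm \<Rightarrow> 'a \<Rightarrow> ('f, 'v) trm \<Rightarrow> bool" where
  "supports G \<rho> p c q \<longleftrightarrow>
     (\<exists>\<sigma>. closed_subst G \<sigma> \<and> (\<forall>l\<in>ante \<rho>. sat_literal G \<sigma> l) \<and>
        subst (source \<rho>) \<sigma> = p \<and> action \<rho> = c \<and> subst (target \<rho>) \<sigma> = q)"

lemma trans_iff_supports:
  assumes "gsos_language G"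
  shows "trans G p c q \<longleftrightarrow> (\<exists>\<rho>\<in>rules G. supports G \<rho> p c q)"
proof -
  have args: "\<exists>f xs. source \<rho> = Op f (map Var xs) \<and>
      (\<forall>x a y. Pos x a y \<in> ante \<rho> \<longrightarrow> x \<in> set xs) \<and> (\<forall>x b. Neg x b \<in> ante \<rho> \<longrightarrow> x \<in> set xs)"
    if \<rho>: "\<rho> \<in> rules G" for \<rho>
  proof -
    obtain f xs where r: "is_ruloid G (Op f (map Var xs)) \<rho>"
      using assms \<rho> unfolding gsos_language_def is_gsos_rule_def by blast
    then have src: "source \<rho> = Op f (map Var xs)"
      by (simp add: is_ruloid_def)
    then have "sourcevars \<rho> = set xs"
      by (simp add: sourcevars_def)
    then show ?thesis
      using r src unfolding is_ruloid_def by (intro exI[of _ f] exI[of _ xs]) simp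
  qed
  show ?thesis
  proof (cases p)
    case (Var x)
    have "\<not> supports G \<rho> p c q" if \<rho>: "\<rho> \<in> rules G" for \<rho>
    proof -
      obtain f xs where "source \<rho> = Op f (map Var xs)"
        using args[OF \<rho>] by blast
      then show ?thesis by (simp add: supports_def Var)
    qed
    then show ?thesis by (simp add: Var)
  next
    case (Op f ps)
    have eq: "(\<forall>p\<in>set ps. \<forall>x. \<sigma> x = p \<longrightarrow>
           (\<forall>a y. Pos x a y \<in> ante \<rho> \<longrightarrow> trans G p a (\<sigma> y)) \<and>
           (\<forall>b. Neg x b \<in> ante \<rho> \<longrightarrow> \<not> (\<exists>p'. trans G p b p')))
         \<longleftrightarrow> (\<forall>l\<in>ante \<rho>. sat_literal G \<sigma> l)" (is "?L \<longleftrightarrow> ?R")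
      if \<rho>: "\<rho> \<in> rules G" and s: "subst (source \<rho>) \<sigma> = Op f ps" for \<rho> \<sigma>
    proof -
      obtain g xs where xs: "source \<rho> = Op g (map Var xs)"
        "\<forall>x a y. Pos x a y \<in> ante \<rho> \<longrightarrow> x \<in> set xs" "\<forall>x b. Neg x b \<in> ante \<rho> \<longrightarrow> x \<in> set xs"
        using args[OF \<rho>] by blast
      have ps: "set ps = \<sigma> ` set xs"
        using s xs(1) by auto
      show ?thesis
      proof
        assume L: ?L
        show ?R
        proof
          fix l assume l: "l \<in> ante \<rho>"
          show "sat_literal G \<sigma> l"
          proof (cases l)
            case (Pos x a y)
            then have "\<sigma> x \<in> set ps" using l xs(2) ps by blast
            then show ?thesis using L l Pos by simp
          next
            case (Neg x b)
            then have "\<sigma> x \<in> set ps" using l xs(3) ps by blast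
            then show ?thesis using L l Neg by simp
          qed
        qed
      next
        assume R: ?R
        show ?L
        proof (intro ballI allI impI conjI)
          fix p x a y assume "\<sigma> x = p" "Pos x a y \<in> ante \<rho>"
          then show "trans G p a (\<sigma> y)" using bspec[OF R, of "Pos x a y"] by simp
        next
          fix p x b assume "\<sigma> x = p" "Neg x b \<in> ante \<rho>"
          then show "\<not> (\<exists>p'. trans G p b p')" using bspec[OF R, of "Neg x b"] by simp
        qed
      qed
    qed
    have "trans G (Op f ps) c q \<longleftrightarrow> (\<exists>\<rho>\<in>rules G. \<exists>\<sigma>. closed_subst G \<sigma> \<and>
        subst (source \<rho>) \<sigma> = Op f ps \<and> action \<rho> = c \<and> subst (target \<rho>) \<sigma> = q \<and>
        (\<forall>l\<in>ante \<rho>. sat_literal G \<sigma> l))"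
      unfolding trans.simps
      by (rule bex_cong[OF refl], rule ex_cong1, intro conj_cong refl, rule eq)
    then show ?thesis
      unfolding Op supports_def by blast
  qed
qed

definition junk :: "('f, 'a, 'v) gsos \<Rightarrow> ('f, 'a, 'v) ruloid \<Rightarrow> bool" where
  "junk G \<rho> \<longleftrightarrow> \<not> (\<exists>p c q. trans G p c q \<and> supports G \<rho> p c q)"

definition bisimulation :: "('f, 'a, 'v) gsos \<Rightarrow> ('f, 'v) trm rel \<Rightarrow> bool" where
  "bisimulation G E \<longleftrightarrow>
     E \<subseteq> closed_terms G \<times> closed_terms G \<and> sym E \<and>
     (\<forall>p q a p'. (p, q) \<in> E \<longrightarrow> trans G p a p' \<longrightarrow> (\<exists>q'. trans G q a q' \<and> (p', q') \<in> E))"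

definition bisimilar :: "('f, 'a, 'v) gsos \<Rightarrow> ('f, 'v) trm \<Rightarrow> ('f, 'v) trm \<Rightarrow> bool" where
  "bisimilar G p q \<longleftrightarrow> (\<exists>E. bisimulation G E \<and> (p, q) \<in> E)"

definition models_eq :: "('f, 'a, 'v) gsos \<Rightarrow> ('f, 'v) trm \<Rightarrow> ('f, 'v) trm \<Rightarrow> bool" where
  "models_eq G P Q \<longleftrightarrow>
     (\<forall>\<sigma>. closed_subst G \<sigma> \<longrightarrow> bisimilar G (subst P \<sigma>) (subst Q \<sigma>))"

definition sound :: "('f, 'a, 'v) gsos \<Rightarrow> ('f, 'a, 'v) ruloid \<Rightarrow> bool" where
  "sound G \<rho> \<longleftrightarrow>
     (\<forall>\<sigma>. closed_subst G \<sigma> \<longrightarrow> (\<forall>l\<in>ante \<rho>. sat_literal G \<sigma> l) \<longrightarrow>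
        trans G (subst (source \<rho>) \<sigma>) (action \<rho>) (subst (target \<rho>) \<sigma>))"

definition supporting ::
  "('f, 'a, 'v) gsos \<Rightarrow> ('f, 'v) trm \<Rightarrow> 'a \<Rightarrow> ('f, 'a, 'v) ruloid set \<Rightarrow> bool" where
  "supporting G D c S \<longleftrightarrow>
     (\<forall>\<rho>\<in>S. source \<rho> = D \<and> action \<rho> = c) \<and>
     (\<forall>\<tau> p. closed_subst G \<tau> \<longrightarrow> trans G (subst D \<tau>) c p \<longrightarrow>
        (\<exists>\<rho>\<in>S. supports G \<rho> (subst D \<tau>) c p))"

text \<open>Sound and supporting sets of ruloids are not unique (their target variables may be renamed,
  for instance), so the choice \<open>P \<mapsto> ruloids(P)\<close> is a parameter \<open>R\<close>, constrained as follows.\<close>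

definition ruloid_choice ::
  "('f, 'a, 'v) gsos \<Rightarrow> (('f, 'v) trm \<Rightarrow> ('f, 'a, 'v) ruloid set) \<Rightarrow> bool" where
  "ruloid_choice G R \<longleftrightarrow>
     (\<forall>P\<in>terms G. \<exists>S. R P = (\<Union>c. S c) \<and>
        (\<forall>c. finite (S c) \<and> (\<forall>\<rho>\<in>S c. is_ruloid G P \<rho> \<and> sound G \<rho>) \<and> supporting G P c (S c)))"

definition persistent ::
  "(('f, 'v) trm \<Rightarrow> ('f, 'a, 'v) ruloid set) \<Rightarrow> ('f, 'v) trm \<Rightarrow> bool" where
  "persistent R P \<longleftrightarrow> (\<forall>\<rho>\<in>R P. source \<rho> = P \<and> target \<rho> = P)"

definition rename :: "('v \<Rightarrow> 'v) \<Rightarrow> ('f, 'a, 'v) ruloid \<Rightarrow> ('f, 'a, 'v) ruloid" where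
  "rename r \<rho> =
     \<lparr>ante = map_literal id r ` ante \<rho>, source = map_trm id r (source \<rho>),
      action = action \<rho>, target = map_trm id r (target \<rho>)\<rparr>"

text \<open>The map \<open>\<sigma>\<close> on the target variables is extended by the identity.\<close>

definition valid_ruloid ::
  "(('f, 'v) trm \<Rightarrow> ('f, 'a, 'v) ruloid set) \<Rightarrow> ('f, 'v) trm \<Rightarrow> ('f, 'a, 'v) ruloid \<Rightarrow> bool" where
  "valid_ruloid R P \<rho> \<longleftrightarrow> source \<rho> = P \<and>
     (\<exists>\<rho>'\<in>R P. \<exists>\<sigma>. inj_on \<sigma> (targetvars \<rho>') \<and> \<sigma> ` targetvars \<rho>' \<subseteq> - sourcevars \<rho> \<and>
        \<rho> = rename (\<lambda>z. if z \<in> targetvars \<rho>' then \<sigma> z else z) \<rho>')"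

datatype ('a, 'v) transition_formula =
    FTrue | FCan 'v 'a | FNot "('a, 'v) transition_formula"
  | FAnd "('a, 'v) transition_formula" "('a, 'v) transition_formula"

primrec sat :: "('f, 'a, 'v) gsos \<Rightarrow> ('v \<Rightarrow> ('f, 'v) trm) \<Rightarrow> ('a, 'v) transition_formula \<Rightarrow> bool" where
  "sat G \<sigma> FTrue \<longleftrightarrow> True"
| "sat G \<sigma> (FCan x a) \<longleftrightarrow> (\<exists>p. trans G (\<sigma> x) a p)"
| "sat G \<sigma> (FNot F) \<longleftrightarrow> \<not> sat G \<sigma> F"
| "sat G \<sigma> (FAnd F F') \<longleftrightarrow> sat G \<sigma> F \<and> sat G \<sigma> F'"

definition entails :: "('f, 'a, 'v) gsos \<Rightarrow> ('a, 'v) transition_formula \<Rightarrow> ('a, 'v) transition_formula \<Rightarrow> bool" where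
  "entails G F F' \<longleftrightarrow> (\<forall>\<sigma>. closed_subst G \<sigma> \<longrightarrow> sat G \<sigma> F \<longrightarrow> sat G \<sigma> F')"

text \<open>Conjunction and disjunction of a finite set of formulae, taken in an arbitrary order.\<close>

definition big_and :: "('a, 'v) transition_formula set \<Rightarrow> ('a, 'v) transition_formula" where
  "big_and A = foldr FAnd (SOME Fs. set Fs = A \<and> distinct Fs) FTrue"

definition big_or :: "('a, 'v) transition_formula set \<Rightarrow> ('a, 'v) transition_formula" where
  "big_or A = FNot (big_and (FNot ` A))"

lemma sat_big_and:
  assumes "finite A"
  shows "sat G \<sigma> (big_and A) \<longleftrightarrow> (\<forall>F\<in>A. sat G \<sigma> F)"
proof -
  have fold: "sat G \<sigma> (foldr FAnd Fs FTrue) \<longleftrightarrow> (\<forall>F\<in>set Fs. sat G \<sigma> F)" for Fs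
    by (induction Fs) auto
  have "set (SOME Fs. set Fs = A \<and> distinct Fs) = A"
    using someI_ex[OF finite_distinct_list[OF assms]] by blast
  then show ?thesis
    unfolding big_and_def fold by simp
qed

lemma sat_big_or:
  assumes "finite A"
  shows "sat G \<sigma> (big_or A) \<longleftrightarrow> (\<exists>F\<in>A. sat G \<sigma> F)"
  using assms by (simp add: big_or_def sat_big_and)

primrec hyp :: "('a, 'v) literal \<Rightarrow> ('a, 'v) transition_formula" where
  "hyp (Pos x a y) = FCan x a"
| "hyp (Neg x b) = FNot (FCan x b)"

definition hyps :: "('a, 'v) literal set \<Rightarrow> ('a, 'v) transition_formula" where
  "hyps H = big_and (hyp ` H)"

definition hyps_any :: "('f, 'a, 'v) ruloid set \<Rightarrow> ('a, 'v) transition_formula" where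
  "hyps_any J = big_or ((\<lambda>\<rho>. hyps (ante \<rho>)) ` J)"

definition rm_bisimulation ::
  "('f, 'a, 'v) gsos \<Rightarrow> (('f, 'v) trm \<Rightarrow> ('f, 'a, 'v) ruloid set) \<Rightarrow> ('f, 'v) trm rel \<Rightarrow> bool" where
  "rm_bisimulation G R E \<longleftrightarrow>
     E \<subseteq> terms G \<times> terms G \<and> sym E \<and>
     (\<forall>P Q. (P, Q) \<in> E \<longrightarrow> (\<forall>\<rho>\<in>R P. \<exists>J. finite J \<and> (\<forall>\<rho>'\<in>J. valid_ruloid R Q \<rho>') \<and>
        (\<forall>\<rho>'\<in>J.
           action \<rho>' = action \<rho> \<and>
           (target \<rho>, target \<rho>') \<in> E \<and>
           (targetvars \<rho>' \<union> targetvars \<rho>) \<inter> (sourcevars \<rho> \<union> sourcevars \<rho>') = {} \<and>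
           (\<forall>y \<in> targetvars \<rho> \<inter> targetvars \<rho>'.
              \<exists>x \<in> sourcevars \<rho> \<inter> sourcevars \<rho>'. \<exists>b. Pos x b y \<in> ante \<rho> \<inter> ante \<rho>')) \<and>
        entails G (hyps (ante \<rho>)) (hyps_any J)))"

definition rm_bisimilar ::
  "('f, 'a, 'v) gsos \<Rightarrow> (('f, 'v) trm \<Rightarrow> ('f, 'a, 'v) ruloid set) \<Rightarrow>
   ('f, 'v) trm \<Rightarrow> ('f, 'v) trm \<Rightarrow> bool" where
  "rm_bisimilar G R P Q \<longleftrightarrow> (\<exists>E. rm_bisimulation G R E \<and> (P, Q) \<in> E)"

end

theory Submission
  imports Defs
begin

text \<open>Soundness holds without persistence: the pairs of closed instances of a rule-matching
  bisimulation form a bisimulation, because the targets of a matching ruloid can be instantiated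
  afresh except where they are shared, and shared ones occur in a common antecedent.
  Conversely, if \<open>P\<close> and \<open>Q\<close> are persistent and equal in the algebra, then \<open>{(P, Q), (Q, P)}\<close> is a
  rule-matching bisimulation: a ruloid for \<open>P\<close> is matched by all ruloids for \<open>Q\<close> with the same
  action, target variables renamed apart. Every target is \<open>P\<close> or \<open>Q\<close> itself, so only the
  enabledness of transitions matters, and that is what the entailment expresses.\<close>

section \<open>Substitutions and transitions\<close>

lemma subst_cong:
  assumes "\<And>x. x \<in> vars t \<Longrightarrow> \<sigma> x = \<tau> x"
  shows "subst t \<sigma> = subst t \<tau>"
  using assms by (induction t) auto

text \<open>Constructors are injective, so an instance of \<open>t\<close> determines the
  substitution on the variables of \<open>t\<close>. This compares the substitution hidden in
  \<open>supports\<close> with the one that produced the closed term.\<close>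

lemma subst_eqD:
  assumes "subst t \<sigma> = subst t \<tau>" "x \<in> vars t"
  shows "\<sigma> x = \<tau> x"
  using assms by (induction t) auto

lemma subst_map_trm: "subst (map_trm id r t) \<sigma> = subst t (\<sigma> \<circ> r)"
  by (induction t) auto

lemma map_trm_vars_id:
  assumes "\<And>x. x \<in> vars t \<Longrightarrow> r x = x"
  shows "map_trm id r t = t"
  using trm.map_cong0[of t id id r id] assms by (simp add: trm.map_id)

lemma wf_trm_map_trm: "wf_trm G (map_trm id r t) \<longleftrightarrow> wf_trm G t"
  by (induction t) auto

lemma finite_vars: "finite (vars t)"
  by (induction t) auto

lemma subst_closed:
  assumes "t \<in> terms G" "closed_subst G \<sigma>"
  shows "subst t \<sigma> \<in> closed_terms G"
  using assms by (induction t) (auto simp: closed_subst_def closed_terms_def terms_def)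

text \<open>Every transition instantiates the target of a rule by a closed substitution. Hence a
  witness of enabledness may itself be a value of a closed substitution.\<close>

lemma trans_target_closed:
  assumes "gsos_language G" "trans G p a q"
  shows "q \<in> closed_terms G"
proof -
  obtain \<rho> where "\<rho> \<in> rules G" "supports G \<rho> p a q"
    using assms(2) unfolding trans_iff_supports[OF assms(1)] by blast
  moreover have "target \<rho> \<in> terms G"
    using assms(1) \<open>\<rho> \<in> rules G\<close>
    unfolding gsos_language_def is_gsos_rule_def is_ruloid_def by blast
  ultimately show ?thesis
    unfolding supports_def using subst_closed by blast
qed

lemma bisimilar_sym: "bisimilar G p q \<Longrightarrow> bisimilar G q p"
  unfolding bisimilar_def bisimulation_def by (meson symD)

lemma models_eq_sym: "models_eq G P Q \<Longrightarrow> models_eq G Q P"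
  unfolding models_eq_def using bisimilar_sym by blast

lemma bisimilar_trans:
  assumes "bisimilar G p q" "trans G p a p'"
  shows "\<exists>q'. trans G q a q'"
  using assms unfolding bisimilar_def bisimulation_def by blast

section \<open>Ruloids\<close>

lemma sat_hyps:
  assumes "finite H"
  shows "sat G \<sigma> (hyps H) \<longleftrightarrow> (\<forall>l\<in>H. sat G \<sigma> (hyp l))"
  using assms by (simp add: hyps_def sat_big_and)

lemma sat_hyps_any:
  assumes "finite J" "\<And>\<rho>. \<rho> \<in> J \<Longrightarrow> finite (ante \<rho>)"
  shows "sat G \<sigma> (hyps_any J) \<longleftrightarrow> (\<exists>\<rho>\<in>J. \<forall>l\<in>ante \<rho>. sat G \<sigma> (hyp l))"
  using assms by (simp add: hyps_any_def sat_big_or sat_hyps)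

text \<open>\<open>hyp\<close> forgets which term a positive antecedent reaches and leaves negative
  antecedents as they are. The way back, in \<open>instantiate_targets\<close>, has to change the
  values of target variables.\<close>

lemma sat_literal_imp_sat_hyp: "sat_literal G \<sigma> l \<Longrightarrow> sat G \<sigma> (hyp l)"
  by (cases l) auto

lemma is_ruloidD:
  assumes "is_ruloid G D \<rho>"
  shows "source \<rho> = D" "D \<in> terms G" "target \<rho> \<in> terms G" "finite (ante \<rho>)"
    "sourcevars \<rho> = vars D" "vars D \<inter> targetvars \<rho> = {}"
    "vars (target \<rho>) \<subseteq> vars D \<union> targetvars \<rho>"
    "\<And>x a y. Pos x a y \<in> ante \<rho> \<Longrightarrow> x \<in> vars D"
    "\<And>x b. Neg x b \<in> ante \<rho> \<Longrightarrow> x \<in> vars D"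
    "\<And>x a x' a' y. Pos x a y \<in> ante \<rho> \<Longrightarrow> Pos x' a' y \<in> ante \<rho> \<Longrightarrow> x = x' \<and> a = a'"
  using assms by (auto simp: is_ruloid_def sourcevars_def)

lemma finite_targetvars:
  assumes "finite (ante \<rho>)"
  shows "finite (targetvars \<rho>)"
proof (rule finite_subset)
  show "targetvars \<rho> \<subseteq> (\<lambda>l. case l of Pos x a y \<Rightarrow> y | Neg x b \<Rightarrow> x) ` ante \<rho>"
    unfolding targetvars_def by force
qed (use assms in simp)

text \<open>The formula of an antecedent mentions only its left variable, which occurs in the
  source.\<close>

lemma sat_hyp_cong:
  assumes "is_ruloid G D \<rho>" "l \<in> ante \<rho>" "\<And>x. x \<in> vars D \<Longrightarrow> \<sigma> x = \<tau> x"
  shows "sat G \<sigma> (hyp l) \<longleftrightarrow> sat G \<tau> (hyp l)"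
  using assms(2) is_ruloidD(8,9)[OF assms(1)] assms(3) by (cases l) auto

text \<open>The targets in \<open>Y\<close> are kept; all other targets are instantiated by witnesses of enabledness.\<close>

lemma instantiate_targets:
  assumes G: "gsos_language G" and \<rho>: "is_ruloid G D \<rho>" and \<sigma>: "closed_subst G \<sigma>"
    and enabled: "\<And>l. l \<in> ante \<rho> \<Longrightarrow> sat G \<sigma> (hyp l)"
    and kept: "\<And>x a y. Pos x a y \<in> ante \<rho> \<Longrightarrow> y \<in> Y \<Longrightarrow> trans G (\<sigma> x) a (\<sigma> y)"
  obtains \<tau> where "closed_subst G \<tau>" "\<And>l. l \<in> ante \<rho> \<Longrightarrow> sat_literal G \<tau> l"
    "\<And>z. z \<notin> targetvars \<rho> - Y \<Longrightarrow> \<tau> z = \<sigma> z"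
proof -
  \<comment> \<open>A target variable occurs in only one positive antecedent, so a single witness
    serves all antecedents that end in \<open>y\<close>.\<close>
  have "\<exists>p. p \<in> closed_terms G \<and> (\<forall>x a. Pos x a y \<in> ante \<rho> \<longrightarrow> trans G (\<sigma> x) a p)"
    if y: "y \<in> targetvars \<rho>" for y
  proof -
    obtain x a where xa: "Pos x a y \<in> ante \<rho>"
      using y by (auto simp: targetvars_def)
    then obtain p where "trans G (\<sigma> x) a p"
      using enabled[OF xa] by auto
    then show ?thesis
      using is_ruloidD(10)[OF \<rho> xa] trans_target_closed[OF G] by blast
  qed
  then obtain w where w: "\<And>y. y \<in> targetvars \<rho> \<Longrightarrow> w y \<in> closed_terms G"
    "\<And>y x a. y \<in> targetvars \<rho> \<Longrightarrow> Pos x a y \<in> ante \<rho> \<Longrightarrow> trans G (\<sigma> x) a (w y)"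
    by metis
  define \<tau> where "\<tau> z = (if z \<in> targetvars \<rho> - Y then w z else \<sigma> z)" for z
  have src: "\<tau> x = \<sigma> x" if "x \<in> vars D" for x
    using that is_ruloidD(6)[OF \<rho>] by (auto simp: \<tau>_def)
  show thesis
  proof (rule that)
    show "closed_subst G \<tau>"
      using \<sigma> w(1) by (auto simp: closed_subst_def \<tau>_def)
    show "sat_literal G \<tau> l" if l: "l \<in> ante \<rho>" for l
    proof (cases l)
      case (Pos x a y)
      then have "y \<in> targetvars \<rho>" "\<tau> x = \<sigma> x"
        using l src is_ruloidD(8)[OF \<rho>] by (auto simp: targetvars_def)
      then show ?thesis
        using l Pos w(2) kept by (auto simp: \<tau>_def)
    next
      case (Neg x b)
      then have "\<tau> x = \<sigma> x"
        using l src is_ruloidD(9)[OF \<rho>] by auto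
      then show ?thesis
        using enabled[OF l] Neg by simp
    qed
  qed (auto simp: \<tau>_def)
qed

lemma ruloid_choiceE:
  assumes "ruloid_choice G R" "D \<in> terms G"
  obtains S where "R D = (\<Union>c. S c)" "\<And>c. finite (S c)" "\<And>c. supporting G D c (S c)"
    "\<And>\<rho>. \<rho> \<in> R D \<Longrightarrow> is_ruloid G D \<rho>" "\<And>\<rho>. \<rho> \<in> R D \<Longrightarrow> sound G \<rho>"
proof -
  obtain S where S: "R D = (\<Union>c. S c)"
    "\<forall>c. finite (S c) \<and> (\<forall>\<rho>\<in>S c. is_ruloid G D \<rho> \<and> sound G \<rho>) \<and> supporting G D c (S c)"
    using bspec[OF assms(1)[unfolded ruloid_choice_def] assms(2)] by (elim exE conjE)
  show thesis
    by (rule that[of S]) (use S in auto)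
qed

text \<open>The substitution \<sigma> found by \<open>supports\<close> yields the same instance of
  \<open>D\<close> as \<tau>, so by \<open>subst_eqD\<close> both agree on \<open>vars D\<close>.
  Elsewhere they may differ.\<close>

lemma supporting_ruloid:
  assumes "supporting G D c S" "closed_subst G \<tau>" "trans G (subst D \<tau>) c p"
  obtains \<rho> \<sigma> where "\<rho> \<in> S" "action \<rho> = c" "closed_subst G \<sigma>"
    "\<And>l. l \<in> ante \<rho> \<Longrightarrow> sat_literal G \<sigma> l" "\<And>x. x \<in> vars D \<Longrightarrow> \<sigma> x = \<tau> x"
    "p = subst (target \<rho>) \<sigma>"
proof -
  obtain \<rho> where \<rho>: "\<rho> \<in> S" "supports G \<rho> (subst D \<tau>) c p" "source \<rho> = D"
    using assms unfolding supporting_def by blast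
  then show thesis
    unfolding supports_def using that subst_eqD by metis
qed

section \<open>Renaming target variables\<close>

lemma sat_literal_map:
  "sat_literal G \<sigma> (map_literal id r l) \<longleftrightarrow> sat_literal G (\<sigma> \<circ> r) l"
  by (cases l) auto

lemma sat_hyp_map: "sat G \<sigma> (hyp (map_literal id r l)) \<longleftrightarrow> sat G (\<sigma> \<circ> r) (hyp l)"
  by (cases l) auto

lemma targetvars_rename: "targetvars (rename r \<rho>) = r ` targetvars \<rho>"
proof (intro equalityI subsetI)
  fix z assume "z \<in> targetvars (rename r \<rho>)"
  then obtain x a l where l: "l \<in> ante \<rho>" "Pos x a z = map_literal id r l"
    by (auto simp: targetvars_def rename_def)
  then show "z \<in> r ` targetvars \<rho>"
    by (cases l) (auto simp: targetvars_def)
next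
  fix z assume "z \<in> r ` targetvars \<rho>"
  then obtain x a y where "Pos x a y \<in> ante \<rho>" "z = r y"
    by (auto simp: targetvars_def)
  then have "Pos (r x) a z \<in> ante (rename r \<rho>)"
    by (force simp: rename_def)
  then show "z \<in> targetvars (rename r \<rho>)"
    by (auto simp: targetvars_def)
qed

text \<open>Applying \<sigma> after renaming by \<open>r\<close> is applying \<sigma> \<circ>
  \<open>r\<close> to the original ruloid, and this substitution is closed again.\<close>

lemma sound_rename:
  assumes "sound G \<rho>"
  shows "sound G (rename r \<rho>)"
proof -
  have "closed_subst G (\<sigma> \<circ> r)" if "closed_subst G \<sigma>" for \<sigma>
    using that by (simp add: closed_subst_def)
  then show ?thesis
    using assms by (auto simp: sound_def rename_def sat_literal_map subst_map_trm)
qed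

locale target_renaming =
  fixes G :: "('f, 'a, 'v) gsos" and D \<rho> s r
  assumes ruloid: "is_ruloid G D \<rho>"
    and inj: "inj_on s (targetvars \<rho>)"
    and avoids_source: "s ` targetvars \<rho> \<subseteq> - vars D"
    and r_def: "r = (\<lambda>z. if z \<in> targetvars \<rho> then s z else z)"
begin

lemma fixes_source: "x \<in> vars D \<Longrightarrow> r x = x"
  using is_ruloidD(6)[OF ruloid] by (auto simp: r_def)

lemma source_rename: "source (rename r \<rho>) = D"
  using is_ruloidD(1)[OF ruloid] map_trm_vars_id[of D r] fixes_source by (simp add: rename_def)

lemma targetvars_renamed: "targetvars (rename r \<rho>) = s ` targetvars \<rho>"
  by (simp add: targetvars_rename r_def)

lemma Pos_renamedE:
  assumes "Pos x a y' \<in> ante (rename r \<rho>)"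
  obtains y where "Pos x a y \<in> ante \<rho>" "y \<in> targetvars \<rho>" "y' = s y"
proof -
  obtain l where l: "l \<in> ante \<rho>" "Pos x a y' = map_literal id r l"
    using assms by (auto simp: rename_def)
  then show thesis
  proof (cases l)
    case (Pos u b y)
    have y: "y \<in> targetvars \<rho>" using l Pos by (auto simp: targetvars_def)
    have "r u = u" using l Pos is_ruloidD(8)[OF ruloid] fixes_source by blast
    then show thesis using that[OF _ y] l Pos y by (simp add: r_def)
  qed auto
qed

text \<open>Injectivity of \<open>s\<close> keeps each target variable in a single positive
  antecedent; avoidance of \<open>vars D\<close> keeps targets and source variables
  disjoint.\<close>

lemma is_ruloid_rename: "is_ruloid G D (rename r \<rho>)"
proof -
  have sv: "sourcevars (rename r \<rho>) = vars D"
    by (simp add: sourcevars_def source_rename)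
  have neg: "x \<in> vars D" if x: "Neg x b \<in> ante (rename r \<rho>)" for x b
  proof -
    obtain l where l: "l \<in> ante \<rho>" "Neg x b = map_literal id r l"
      using x by (auto simp: rename_def)
    then show ?thesis
      using is_ruloidD(9)[OF ruloid] fixes_source by (cases l) auto
  qed
  have uniq: "x = x' \<and> a = a'"
    if "Pos x a y \<in> ante (rename r \<rho>)" "Pos x' a' y \<in> ante (rename r \<rho>)" for x a x' a' y
    using that inj is_ruloidD(10)[OF ruloid] by (metis Pos_renamedE inj_onD)
  have "vars (target (rename r \<rho>)) = r ` vars (target \<rho>)"
    by (simp add: rename_def trm.set_map)
  also have "\<dots> \<subseteq> vars D \<union> s ` targetvars \<rho>"
    using is_ruloidD(7)[OF ruloid] fixes_source by (auto simp: r_def)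
  finally have tgt: "vars (target (rename r \<rho>)) \<subseteq> vars D \<union> s ` targetvars \<rho>" .
  have pos: "x \<in> vars D" if "Pos x a y \<in> ante (rename r \<rho>)" for x a y
    using that is_ruloidD(8)[OF ruloid] by (metis Pos_renamedE)
  have wf: "target (rename r \<rho>) \<in> terms G"
    using is_ruloidD(3)[OF ruloid] by (simp add: rename_def terms_def wf_trm_map_trm)
  have fin: "finite (ante (rename r \<rho>))"
    using is_ruloidD(4)[OF ruloid] by (simp add: rename_def)
  show ?thesis
    unfolding is_ruloid_def sv targetvars_renamed
  proof (intro conjI allI impI)
    show "vars D \<inter> s ` targetvars \<rho> = {}"
      using avoids_source by blast
  qed (use source_rename is_ruloidD(2)[OF ruloid] wf fin tgt in simp_all,
       (use pos neg uniq in metis)+)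
qed

text \<open>Enabledness depends on source variables only, and \<open>r\<close> fixes these.\<close>

lemma sat_hyps_rename:
  assumes "\<And>l. l \<in> ante \<rho> \<Longrightarrow> sat G \<sigma> (hyp l)" "l' \<in> ante (rename r \<rho>)"
  shows "sat G \<sigma> (hyp l')"
proof -
  obtain l where l: "l \<in> ante \<rho>" "l' = map_literal id r l"
    using assms(2) by (auto simp: rename_def)
  have "sat G (\<sigma> \<circ> r) (hyp l) \<longleftrightarrow> sat G \<sigma> (hyp l)"
    using fixes_source by (intro sat_hyp_cong[OF ruloid l(1)]) simp
  then show ?thesis
    using assms(1) l by (simp add: sat_hyp_map)
qed

end

text \<open>Renaming targets preserves shape and soundness, so the members of a matching set can be
  fired just like the chosen ruloids.\<close>

lemma valid_ruloid_sound:
  assumes "ruloid_choice G R" "D \<in> terms G" "valid_ruloid R D \<rho>"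
  shows "is_ruloid G D \<rho>" "sound G \<rho>"
proof -
  obtain \<rho>0 s where \<rho>0: "\<rho>0 \<in> R D" "source \<rho> = D" "inj_on s (targetvars \<rho>0)"
    "s ` targetvars \<rho>0 \<subseteq> - sourcevars \<rho>"
    "\<rho> = rename (\<lambda>z. if z \<in> targetvars \<rho>0 then s z else z) \<rho>0"
    using assms(3) unfolding valid_ruloid_def by blast
  obtain "is_ruloid G D \<rho>0" "sound G \<rho>0"
    using ruloid_choiceE[OF assms(1,2)] \<rho>0(1) by metis
  then interpret target_renaming G D \<rho>0 s "\<lambda>z. if z \<in> targetvars \<rho>0 then s z else z"
    using \<rho>0 by unfold_locales (auto simp: sourcevars_def)
  show "is_ruloid G D \<rho>" "sound G \<rho>"
    using is_ruloid_rename sound_rename[OF \<open>sound G \<rho>0\<close>] \<rho>0(5) by auto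
qed

text \<open>The complement of \<open>B\<close> is infinite and so contains a set of the cardinality
  of \<open>A\<close>; a bijection onto that set is the renaming.\<close>

lemma fresh_renaming:
  fixes A B :: "'v :: infinite set"
  assumes "finite A" "finite B"
  obtains s where "inj_on s A" "s ` A \<inter> B = {}"
proof -
  have "infinite (- B)"
    using assms(2) by (simp add: infinite_UNIV)
  then obtain C where C: "C \<subseteq> - B" "finite C" "card C = card A"
    using infinite_arbitrarily_large by blast
  then obtain s where "bij_betw s A C"
    using assms(1) finite_same_card_bij by metis
  then show thesis
    using that[of s] C(1) by (auto simp: bij_betw_def)
qed

section \<open>Rule-matching bisimilarity and equality\<close>

theorem rm_bisimilar_imp_models_eq:
  assumes G: "gsos_language G" and R: "ruloid_choice G R" and "rm_bisimilar G R P Q"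
  shows "models_eq G P Q"
proof -
  obtain E where E: "rm_bisimulation G R E" and PQ: "(P, Q) \<in> E"
    using assms(3) by (auto simp: rm_bisimilar_def)
  have wf: "E \<subseteq> terms G \<times> terms G" and symE: "sym E"
    using E by (auto simp: rm_bisimulation_def)
  define B where "B = {(subst P \<sigma>, subst Q \<sigma>) | P Q \<sigma>. (P, Q) \<in> E \<and> closed_subst G \<sigma>}"
  have "bisimulation G B"
    unfolding bisimulation_def
  proof (intro conjI allI impI)
    show "B \<subseteq> closed_terms G \<times> closed_terms G"
      using wf subst_closed by (fastforce simp: B_def)
    show "sym B"
      using symE unfolding B_def sym_def by blast
    fix p q a p' assume "(p, q) \<in> B" and tr: "trans G p a p'"
    then obtain P Q \<sigma> where p: "p = subst P \<sigma>" and q: "q = subst Q \<sigma>"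
      and PQ: "(P, Q) \<in> E" and \<sigma>: "closed_subst G \<sigma>"
      by (auto simp: B_def)
    then have P: "P \<in> terms G" and Q: "Q \<in> terms G" using wf by auto
    obtain S where S: "R P = (\<Union>c. S c)" "\<And>c. supporting G P c (S c)"
      "\<And>\<rho>. \<rho> \<in> R P \<Longrightarrow> is_ruloid G P \<rho>"
      using ruloid_choiceE[OF R P] by metis
    obtain \<rho> \<mu> where "\<rho> \<in> S a" and act: "action \<rho> = a" and \<mu>: "closed_subst G \<mu>"
      and ant: "\<And>l. l \<in> ante \<rho> \<Longrightarrow> sat_literal G \<mu> l"
      and src: "\<And>x. x \<in> vars P \<Longrightarrow> \<mu> x = \<sigma> x" and p': "p' = subst (target \<rho>) \<mu>"
      using supporting_ruloid[OF S(2) \<sigma> tr[unfolded p]] by metis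
    then have \<rho>: "\<rho> \<in> R P" and rul: "is_ruloid G P \<rho>" using S by blast+
    obtain J where J: "finite J" "\<forall>\<rho>'\<in>J. valid_ruloid R Q \<rho>'"
      and match: "\<forall>\<rho>'\<in>J.
           action \<rho>' = action \<rho> \<and>
           (target \<rho>, target \<rho>') \<in> E \<and>
           (targetvars \<rho>' \<union> targetvars \<rho>) \<inter> (sourcevars \<rho> \<union> sourcevars \<rho>') = {} \<and>
           (\<forall>y \<in> targetvars \<rho> \<inter> targetvars \<rho>'.
              \<exists>x \<in> sourcevars \<rho> \<inter> sourcevars \<rho>'. \<exists>b. Pos x b y \<in> ante \<rho> \<inter> ante \<rho>')"
      and ent: "entails G (hyps (ante \<rho>)) (hyps_any J)"
      using E[unfolded rm_bisimulation_def, THEN conjunct2, THEN conjunct2, rule_format, OF PQ \<rho>]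
      by (elim exE conjE) (rule that)
    have rulJ: "is_ruloid G Q \<rho>'" "sound G \<rho>'" if "\<rho>' \<in> J" for \<rho>'
      using valid_ruloid_sound[OF R Q bspec[OF J(2) that]] by auto
    \<comment> \<open>\<mu> agrees with \<sigma> on \<open>vars P\<close> but perhaps not on
      \<open>vars Q\<close>. The mixture \<nu> follows \<mu> on all variables of \<rho> and, once
      the targets of \<rho> are known to miss \<open>vars Q\<close>, follows \<sigma> on
      \<open>vars Q\<close>.\<close>
    define \<nu> where "\<nu> z = (if z \<in> targetvars \<rho> then \<mu> z else \<sigma> z)" for z
    have \<nu>: "closed_subst G \<nu>"
      using \<mu> \<sigma> by (simp add: closed_subst_def \<nu>_def)
    have \<nu>\<mu>: "\<nu> z = \<mu> z" if "z \<in> vars P \<union> targetvars \<rho>" for z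
      using that src by (auto simp: \<nu>_def)
    have ant\<nu>: "sat_literal G \<nu> l" if l: "l \<in> ante \<rho>" for l
    proof (cases l)
      case (Pos x b y)
      then have "\<nu> x = \<mu> x" "\<nu> y = \<mu> y"
        using l is_ruloidD(8)[OF rul] by (auto intro!: \<nu>\<mu> simp: targetvars_def)
      then show ?thesis using ant[OF l] Pos by simp
    next
      case (Neg x b)
      then have "\<nu> x = \<mu> x"
        using l is_ruloidD(9)[OF rul] by (auto intro!: \<nu>\<mu>)
      then show ?thesis using ant[OF l] Neg by simp
    qed
    \<comment> \<open>The entailment selects a ruloid in \<open>J\<close> whose antecedents are
      enabled under \<nu>; its targets need not yet have suitable values.\<close>
    have "sat G \<nu> (hyps_any J)"
      using ent \<nu> ant\<nu> sat_literal_imp_sat_hyp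
      unfolding entails_def sat_hyps[OF is_ruloidD(4)[OF rul]] by blast
    then obtain \<rho>' where \<rho>': "\<rho>' \<in> J" and en: "\<And>l. l \<in> ante \<rho>' \<Longrightarrow> sat G \<nu> (hyp l)"
      using sat_hyps_any[OF J(1)] rulJ(1) is_ruloidD(4) by metis
    have rul': "is_ruloid G Q \<rho>'" using rulJ(1) \<rho>' .
    \<comment> \<open>Condition (c) of the matching: giving new values to targets of \<rho>' cannot
      affect \<open>P\<close>, and the values \<nu> gives to targets of \<rho> cannot affect
      \<open>Q\<close>.\<close>
    have disj: "targetvars \<rho>' \<inter> vars P = {}" "targetvars \<rho> \<inter> vars Q = {}"
      using match \<rho>' is_ruloidD(5)[OF rul] is_ruloidD(5)[OF rul'] by blast+
    \<comment> \<open>By condition (d) a shared target \<open>y\<close> ends a common antecedent of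
      \<rho> and \<rho>'. Uniqueness within \<rho>' identifies it with the given one, and \<nu>
      satisfies it as an antecedent of \<rho>.\<close>
    have kept: "trans G (\<nu> x) b (\<nu> y)"
      if xy: "Pos x b y \<in> ante \<rho>'" and y: "y \<in> targetvars \<rho>" for x b y
    proof -
      have "y \<in> targetvars \<rho>'" using xy by (auto simp: targetvars_def)
      then obtain x' b' where "Pos x' b' y \<in> ante \<rho>" "Pos x' b' y \<in> ante \<rho>'"
        using match \<rho>' y by blast
      then show ?thesis
        using is_ruloidD(10)[OF rul' xy] ant\<nu> by fastforce
    qed
    \<comment> \<open>Only targets of \<rho>' that are not shared with \<rho> change. So \<tau>
      still produces \<open>q\<close> and \<open>p'\<close>, and the answering transition ends in an
      instance under the same \<tau>, as membership in \<open>B\<close> requires.\<close>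
    obtain \<tau> where \<tau>: "closed_subst G \<tau>" "\<And>l. l \<in> ante \<rho>' \<Longrightarrow> sat_literal G \<tau> l"
      "\<And>z. z \<notin> targetvars \<rho>' - targetvars \<rho> \<Longrightarrow> \<tau> z = \<nu> z"
      using instantiate_targets[OF G rul' \<nu> en kept] by blast
    have "subst Q \<tau> = q"
      unfolding q
    proof (rule subst_cong)
      fix x assume x: "x \<in> vars Q"
      then have "x \<notin> targetvars \<rho>'" "x \<notin> targetvars \<rho>"
        using is_ruloidD(6)[OF rul'] disj by auto
      then show "\<tau> x = \<sigma> x" using \<tau>(3) by (simp add: \<nu>_def)
    qed
    moreover have "subst (target \<rho>) \<tau> = p'"
      unfolding p'
    proof (rule subst_cong)
      fix x assume "x \<in> vars (target \<rho>)"
      then have x: "x \<in> vars P \<union> targetvars \<rho>"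
        using is_ruloidD(7)[OF rul] by auto
      then have "x \<notin> targetvars \<rho>' - targetvars \<rho>"
        using disj(1) by blast
      then show "\<tau> x = \<mu> x" using \<tau>(3) \<nu>\<mu>[OF x] by simp
    qed
    moreover have "trans G (subst (source \<rho>') \<tau>) (action \<rho>') (subst (target \<rho>') \<tau>)"
      using rulJ(2)[OF \<rho>'] \<tau>(1,2) by (auto simp: sound_def)
    moreover have "action \<rho>' = a" "(target \<rho>, target \<rho>') \<in> E"
      using match \<rho>' act by auto
    ultimately have "trans G q a (subst (target \<rho>') \<tau>)" "(p', subst (target \<rho>') \<tau>) \<in> B"
      using is_ruloidD(1)[OF rul'] \<tau>(1) unfolding B_def by auto
    then show "\<exists>q'. trans G q a q' \<and> (p', q') \<in> B" by blast
  qed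
  then show ?thesis
    using PQ unfolding models_eq_def bisimilar_def B_def by blast
qed

text \<open>The matching for one orientation of the pair. If \<rho> is enabled, \<open>P\<close> can
  move, hence so can the equal \<open>Q\<close>, and some ruloid of \<open>Q\<close> with the same
  action supports that move. Disjoint target variables leave no shared target for condition
  (d).\<close>

lemma persistent_matching_ruloids:
  fixes G :: "('f, 'a, 'v :: infinite) gsos"
  assumes G: "gsos_language G" and R: "ruloid_choice G R"
    and P: "P \<in> terms G" and Q: "Q \<in> terms G"
    and pP: "persistent R P" and pQ: "persistent R Q"
    and apart: "\<forall>\<rho>\<in>R P. targetvars \<rho> \<inter> vars Q = {}"
    and eq: "models_eq G P Q" and \<rho>: "\<rho> \<in> R P"
  shows "\<exists>J. finite J \<and> (\<forall>\<rho>'\<in>J. valid_ruloid R Q \<rho>') \<and>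
        (\<forall>\<rho>'\<in>J.
           action \<rho>' = action \<rho> \<and> target \<rho>' = Q \<and>
           (targetvars \<rho>' \<union> targetvars \<rho>) \<inter> (sourcevars \<rho> \<union> sourcevars \<rho>') = {} \<and>
           targetvars \<rho> \<inter> targetvars \<rho>' = {}) \<and>
        entails G (hyps (ante \<rho>)) (hyps_any J)"
proof -
  have rul: "is_ruloid G P \<rho>" and snd: "sound G \<rho>"
    using ruloid_choiceE[OF R P] \<rho> by metis+
  have tP: "target \<rho> = P" using pP \<rho> by (auto simp: persistent_def)
  obtain S where S: "R Q = (\<Union>c. S c)" "\<And>c. finite (S c)" "\<And>c. supporting G Q c (S c)"
    "\<And>\<rho>. \<rho> \<in> R Q \<Longrightarrow> is_ruloid G Q \<rho>"
    using ruloid_choiceE[OF R Q] by metis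
  define S' where "S' = S (action \<rho>)"
  have SR: "\<rho>' \<in> R Q" and rulS: "is_ruloid G Q \<rho>'" and actS: "action \<rho>' = action \<rho>"
    if "\<rho>' \<in> S'" for \<rho>'
    using that S(1,4) S(3)[of "action \<rho>"] by (auto simp: S'_def supporting_def)
  \<comment> \<open>All targets are collected so that one injective \<open>s\<close> renames every
    member of \<open>S'\<close>. Its values avoid \<open>targetvars \<rho>\<close> so that no target
    is shared, and \<open>vars P\<close> and \<open>vars Q\<close> for condition (c).\<close>
  define A where "A = (\<Union>\<rho>'\<in>S'. targetvars \<rho>')"
  have "finite A"
    unfolding A_def using S(2) rulS is_ruloidD(4) finite_targetvars by (metis S'_def finite_UN)
  moreover have "finite (targetvars \<rho> \<union> vars P \<union> vars Q)"
    using finite_targetvars[OF is_ruloidD(4)[OF rul]] finite_vars by blast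
  ultimately obtain s where s: "inj_on s A" "s ` A \<inter> (targetvars \<rho> \<union> vars P \<union> vars Q) = {}"
    using fresh_renaming by metis
  define r where "r \<rho>' = (\<lambda>z. if z \<in> targetvars \<rho>' then s z else z)" for \<rho>' :: "('f, 'a, 'v) ruloid"
  have ren: "target_renaming G Q \<rho>' s (r \<rho>')" if "\<rho>' \<in> S'" for \<rho>'
  proof
    have sub: "targetvars \<rho>' \<subseteq> A" using that by (auto simp: A_def)
    show "is_ruloid G Q \<rho>'" using rulS that .
    show "inj_on s (targetvars \<rho>')" using s(1) sub inj_on_subset by blast
    show "s ` targetvars \<rho>' \<subseteq> - vars Q" using s(2) sub by blast
  qed (simp add: r_def)
  define J where "J = (\<lambda>\<rho>'. rename (r \<rho>') \<rho>') ` S'"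
  have finJ: "finite J" using S(2) by (simp add: J_def S'_def)
  have J: "valid_ruloid R Q \<rho>'' \<and> finite (ante \<rho>'') \<and> action \<rho>'' = action \<rho> \<and> target \<rho>'' = Q \<and>
     (targetvars \<rho>'' \<union> targetvars \<rho>) \<inter> (sourcevars \<rho> \<union> sourcevars \<rho>'') = {} \<and>
     targetvars \<rho> \<inter> targetvars \<rho>'' = {}" if J: "\<rho>'' \<in> J" for \<rho>''
  proof -
    obtain \<rho>' where \<rho>': "\<rho>' \<in> S'" and \<rho>'': "\<rho>'' = rename (r \<rho>') \<rho>'"
      using J by (auto simp: J_def)
    interpret target_renaming G Q \<rho>' s "r \<rho>'" using ren \<rho>' .
    have src: "source \<rho>'' = Q" "sourcevars \<rho>'' = vars Q"
      using source_rename \<rho>'' by (auto simp: sourcevars_def)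
    have "target \<rho>' = Q" using pQ SR[OF \<rho>'] by (auto simp: persistent_def)
    then have "target \<rho>'' = Q"
      using map_trm_vars_id[of Q "r \<rho>'"] fixes_source by (simp add: \<rho>'' rename_def)
    moreover have "valid_ruloid R Q \<rho>''"
      unfolding valid_ruloid_def
    proof (intro conjI bexI[of _ \<rho>'] exI[of _ s])
      show "\<rho>'' = rename (\<lambda>z. if z \<in> targetvars \<rho>' then s z else z) \<rho>'"
        using \<rho>'' r_def by simp
    qed (use src SR[OF \<rho>'] inj avoids_source in simp_all)
    moreover have fresh: "targetvars \<rho>'' \<inter> (targetvars \<rho> \<union> vars P \<union> vars Q) = {}"
      using targetvars_renamed \<rho>'' s(2) \<rho>' by (auto simp: A_def)
    moreover have "finite (ante \<rho>'')" "action \<rho>'' = action \<rho>"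
      using is_ruloidD(4)[OF rulS[OF \<rho>']] actS[OF \<rho>'] by (auto simp: \<rho>'' rename_def)
    \<comment> \<open>The renamed targets are fresh. \<rho> itself is not renamed: its targets miss
      \<open>vars P\<close> because \<rho> is a ruloid, and miss \<open>vars Q\<close> by
      \<open>apart\<close>.\<close>
    moreover have "(targetvars \<rho>'' \<union> targetvars \<rho>) \<inter> (sourcevars \<rho> \<union> sourcevars \<rho>'') = {}"
      unfolding src is_ruloidD(5)[OF rul] using fresh bspec[OF apart \<rho>] is_ruloidD(6)[OF rul] by blast
    moreover have "targetvars \<rho> \<inter> targetvars \<rho>'' = {}"
      using fresh by blast
    ultimately show ?thesis
      by simp
  qed
  have "sat G \<sigma> (hyps_any J)" if \<sigma>: "closed_subst G \<sigma>" and en: "sat G \<sigma> (hyps (ante \<rho>))" for \<sigma>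
  proof -
    have en': "\<And>l. l \<in> ante \<rho> \<Longrightarrow> sat G \<sigma> (hyp l)"
      using en sat_hyps[OF is_ruloidD(4)[OF rul]] by blast
    \<comment> \<open>With nothing kept, all targets of \<rho> receive witnesses, so that \<rho> can
      be fired under \<tau>.\<close>
    obtain \<tau> where \<tau>: "closed_subst G \<tau>" "\<And>l. l \<in> ante \<rho> \<Longrightarrow> sat_literal G \<tau> l"
      "\<And>z. z \<notin> targetvars \<rho> \<Longrightarrow> \<tau> z = \<sigma> z"
      using instantiate_targets[OF G rul \<sigma> en', of "{}"] by auto
    have "trans G (subst P \<tau>) (action \<rho>) (subst P \<tau>)"
      using snd \<tau>(1,2) tP is_ruloidD(1)[OF rul] by (auto simp: sound_def)
    then obtain q where q: "trans G (subst Q \<tau>) (action \<rho>) q"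
      using bisimilar_trans eq \<tau>(1) unfolding models_eq_def by metis
    obtain \<rho>' \<mu> where \<rho>': "\<rho>' \<in> S'"
      and \<mu>: "\<And>l. l \<in> ante \<rho>' \<Longrightarrow> sat_literal G \<mu> l" "\<And>x. x \<in> vars Q \<Longrightarrow> \<mu> x = \<tau> x"
      using supporting_ruloid[OF S(3) \<tau>(1) q] unfolding S'_def by metis
    \<comment> \<open>\<tau> differs from \<sigma> only at targets of \<rho>, and
      \<open>apart\<close> keeps these out of \<open>vars Q\<close>. So the antecedents of \<rho>',
      true under \<mu>, are enabled under the original \<sigma>.\<close>
    have \<mu>\<sigma>: "\<mu> x = \<sigma> x" if "x \<in> vars Q" for x
      using that \<mu>(2) \<tau>(3) apart \<rho> by auto
    have "sat G \<sigma> (hyp l)" if l: "l \<in> ante \<rho>'" for l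
      using sat_hyp_cong[OF rulS[OF \<rho>'] l \<mu>\<sigma>] sat_literal_imp_sat_hyp[OF \<mu>(1)[OF l]] by simp
    then have "\<forall>l\<in>ante (rename (r \<rho>') \<rho>'). sat G \<sigma> (hyp l)"
      using target_renaming.sat_hyps_rename[OF ren[OF \<rho>']] by blast
    then show ?thesis
      using sat_hyps_any[OF finJ] J \<rho>' by (auto simp: J_def)
  qed
  then have "entails G (hyps (ante \<rho>)) (hyps_any J)"
    by (simp add: entails_def)
  then show ?thesis
    using finJ J by (intro exI[of _ J]) simp
qed

theorem theorem7p1:
  fixes G :: "('f, 'a :: finite, 'v :: {countable, infinite}) gsos"
    and R :: "('f, 'v) trm \<Rightarrow> ('f, 'a, 'v) ruloid set"
    and P Q :: "('f, 'v) trm"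
  assumes "gsos_language G"
    and "\<forall>\<rho>\<in>rules G. \<not> junk G \<rho>"
    and "ruloid_choice G R"
    and "\<forall>D\<in>terms G. \<forall>\<rho>\<in>R D. \<not> junk G \<rho>"
    and "P \<in> terms G" and "Q \<in> terms G"
    and "persistent R P" and "persistent R Q"
    \<comment> \<open>target variables of the chosen ruloids are bound names, chosen apart from both terms\<close>
    and "\<forall>\<rho>\<in>R P. targetvars \<rho> \<inter> vars Q = {}"
    and "\<forall>\<rho>\<in>R Q. targetvars \<rho> \<inter> vars P = {}"
  shows "models_eq G P Q \<longleftrightarrow> rm_bisimilar G R P Q"
proof
  assume eq: "models_eq G P Q"
  let ?E = "{(P, Q), (Q, P)}"
  \<comment> \<open>The facts about \<open>P\<close> and \<open>Q\<close> that the matching uses are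
    symmetric in the two terms, so both orientations are treated at once.\<close>
  have match: "\<exists>J. finite J \<and> (\<forall>\<rho>'\<in>J. valid_ruloid R B \<rho>') \<and>
        (\<forall>\<rho>'\<in>J.
           action \<rho>' = action \<rho> \<and>
           (target \<rho>, target \<rho>') \<in> ?E \<and>
           (targetvars \<rho>' \<union> targetvars \<rho>) \<inter> (sourcevars \<rho> \<union> sourcevars \<rho>') = {} \<and>
           (\<forall>y \<in> targetvars \<rho> \<inter> targetvars \<rho>'.
              \<exists>x \<in> sourcevars \<rho> \<inter> sourcevars \<rho>'. \<exists>b. Pos x b y \<in> ante \<rho> \<inter> ante \<rho>')) \<and>
        entails G (hyps (ante \<rho>)) (hyps_any J)"
    if AB: "(A, B) \<in> ?E" and \<rho>: "\<rho> \<in> R A" for A B \<rho>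
  proof -
    have "A \<in> terms G" "B \<in> terms G" "persistent R A" "persistent R B" "models_eq G A B"
      "\<forall>\<rho>\<in>R A. targetvars \<rho> \<inter> vars B = {}"
      using AB assms(5-10) eq models_eq_sym[OF eq] by auto
    from persistent_matching_ruloids[OF assms(1,3) this(1-4) this(6) this(5) \<rho>]
    obtain J where J: "finite J" "\<forall>\<rho>'\<in>J. valid_ruloid R B \<rho>'"
      "\<forall>\<rho>'\<in>J. action \<rho>' = action \<rho> \<and> target \<rho>' = B \<and>
           (targetvars \<rho>' \<union> targetvars \<rho>) \<inter> (sourcevars \<rho> \<union> sourcevars \<rho>') = {} \<and>
           targetvars \<rho> \<inter> targetvars \<rho>' = {}"
      "entails G (hyps (ante \<rho>)) (hyps_any J)"
      by blast
    \<comment> \<open>By persistence the target of \<rho> is \<open>A\<close>, so the pair of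
      targets is the pair \<open>(A, B)\<close> itself.\<close>
    have "(target \<rho>, B) \<in> ?E"
      using \<open>persistent R A\<close> \<rho> AB by (simp add: persistent_def)
    then show ?thesis
      using J by (intro exI[of _ J]) auto
  qed
  have "rm_bisimulation G R ?E"
    unfolding rm_bisimulation_def
  proof (intro conjI allI impI ballI)
    show "?E \<subseteq> terms G \<times> terms G" using assms(5,6) by simp
    show "sym ?E" by (auto simp: sym_def)
  qed (rule match)
  then show "rm_bisimilar G R P Q"
    unfolding rm_bisimilar_def by blast
next
  assume "rm_bisimilar G R P Q"
  then show "models_eq G P Q"
    using rm_bisimilar_imp_models_eq[OF assms(1,3)] by blast
qed

end
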